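(* A paratopological lop $X$ is a $\mathfrak P_0$-space if and only if $X$ is a cosmic space with the strong Pytkeev property.
   Context: "Regular" means $T_3$. A lop is a set $X$ endowed with a binary operation $X\times X\to X$, $(x,y)\mapsto xy$, that has a unit $e\in X$ (i.e. $xe=x=ex$ for all $x\in X$) and such that for every $a\in X$ the left shift $L_a:X\to X$, $L_a(x)=ax$, is bijective (associativity is not assumed). A paratopological lop is a lop endowed with a topology such that the multiplication $X\times X\to X$, $(x,y)\mapsto xy$, is (jointly) continuous and all left shifts $L_a:X\to X$, $a\in X$, are homeomorphisms. A subset $A$ of a topological space $X$ accumulates at a point $x\in X$ if each neighborhood of $x$ contains infinitely many points of $A$. A family $\mathcal N$ of subsets of $X$ is a network at $x\in X$ if for any neighborhood $O_x$ of $x$ there is $N\in\mathcal N$ with $x\in N\subset O_x$; it is a network if it is a network at each point. It is a Pytkeev network at $x$ if it is a network at $x$ and for each neighborhood $O_x$ of $x$ and each subset $A\subset X$ accumulating at $x$ there is $N\in\mathcal N$ such that $N\subset O_x$ and $N\cap A$ is infinite. It is a Pytkeev network for $X$ if it is a Pytkeev network at each point $x\in X$. A $\mathfrak P_0$-space is a regular space with a countable Pytkeev network. A cosmic space is a regular space with a countable network. A topological space $X$ has the strong Pytkeev property if $X$ has a countable Pytkeev network at each point $x\in X$. *)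

theory Defs
  imports "HOL-Analysis.Analysis"
begin

locale lop =
  fixes X :: "'a set" and mult :: "'a \<Rightarrow> 'a \<Rightarrow> 'a" and e :: 'a
  assumes mult_closed: "x \<in> X \<Longrightarrow> y \<in> X \<Longrightarrow> mult x y \<in> X"
    and unit_closed: "e \<in> X"
    and right_unit: "x \<in> X \<Longrightarrow> mult x e = x"
    and left_unit: "x \<in> X \<Longrightarrow> mult e x = x"
    and bij_left_shift: "a \<in> X \<Longrightarrow> bij_betw (mult a) X X"

locale paratopological_lop = lop "topspace T" mult e
  for T :: "'a topology" and mult :: "'a \<Rightarrow> 'a \<Rightarrow> 'a" and e :: 'a +
  assumes continuous_mult: "continuous_map (prod_topology T T) T (\<lambda>(x, y). mult x y)"
    and homeomorphic_left_shift: "a \<in> topspace T \<Longrightarrow> homeomorphic_map T T (mult a)"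

text \<open>
  As in Engelking's book, a neighborhood of a point is an open set containing it.
\<close>

definition accumulates_at :: "'a topology \<Rightarrow> 'a set \<Rightarrow> 'a \<Rightarrow> bool" where
  "accumulates_at T A x \<longleftrightarrow> (\<forall>U. openin T U \<and> x \<in> U \<longrightarrow> infinite (U \<inter> A))"

definition network_at :: "'a topology \<Rightarrow> 'a set set \<Rightarrow> 'a \<Rightarrow> bool" where
  "network_at T \<N> x \<longleftrightarrow>
     \<N> \<subseteq> Pow (topspace T) \<and>
     (\<forall>U. openin T U \<and> x \<in> U \<longrightarrow> (\<exists>N\<in>\<N>. x \<in> N \<and> N \<subseteq> U))"

definition network :: "'a topology \<Rightarrow> 'a set set \<Rightarrow> bool" where
  "network T \<N> \<longleftrightarrow> (\<forall>x\<in>topspace T. network_at T \<N> x)"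

text \<open>
  The set \<open>N\<close> in the second condition is not required to contain \<open>x\<close>.
\<close>

definition Pytkeev_network_at :: "'a topology \<Rightarrow> 'a set set \<Rightarrow> 'a \<Rightarrow> bool" where
  "Pytkeev_network_at T \<N> x \<longleftrightarrow>
     network_at T \<N> x \<and>
     (\<forall>U A. openin T U \<and> x \<in> U \<and> A \<subseteq> topspace T \<and> accumulates_at T A x
        \<longrightarrow> (\<exists>N\<in>\<N>. N \<subseteq> U \<and> infinite (N \<inter> A)))"

definition Pytkeev_network :: "'a topology \<Rightarrow> 'a set set \<Rightarrow> bool" where
  "Pytkeev_network T \<N> \<longleftrightarrow> (\<forall>x\<in>topspace T. Pytkeev_network_at T \<N> x)"

text \<open>
  The library's \<^const>\<open>regular_space\<close> does not include any \<open>T\<^sub>1\<close> condition.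
\<close>

definition T3_space :: "'a topology \<Rightarrow> bool" where
  "T3_space T \<longleftrightarrow> regular_space T \<and> t1_space T"

definition P0_space :: "'a topology \<Rightarrow> bool" where
  "P0_space T \<longleftrightarrow> T3_space T \<and> (\<exists>\<N>. countable \<N> \<and> Pytkeev_network T \<N>)"

definition cosmic_space :: "'a topology \<Rightarrow> bool" where
  "cosmic_space T \<longleftrightarrow> T3_space T \<and> (\<exists>\<N>. countable \<N> \<and> network T \<N>)"

definition strong_Pytkeev_property :: "'a topology \<Rightarrow> bool" where
  "strong_Pytkeev_property T \<longleftrightarrow>
     (\<forall>x\<in>topspace T. \<exists>\<N>. countable \<N> \<and> Pytkeev_network_at T \<N> x)"

end

theory Submission
  imports Defs
begin

text \<open>
  The substantial implication builds a countable Pytkeev network for the whole space out of a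
  countable network \<open>\<C>\<close> and a countable Pytkeev network \<open>\<N>\<close> at the unit: it consists of the products
  \<open>C N\<close> with \<open>C \<in> \<C>\<close> and \<open>N \<in> \<N>\<close>.  Let \<open>U\<close> be a neighborhood of \<open>x\<close>.  Since \<open>x e = x\<close>, joint continuity
  gives neighborhoods \<open>V\<close> of \<open>x\<close> and \<open>W\<close> of \<open>e\<close> with \<open>V W \<subseteq> U\<close>, and \<open>\<C>\<close> supplies \<open>C\<close> with
  \<open>x \<in> C \<subseteq> V\<close>.  The set \<open>N \<subseteq> W\<close> is chosen for the situation at \<open>e\<close>: if \<open>A\<close> accumulates at \<open>x\<close>, then
  its preimage under the homeomorphism \<open>L\<^sub>x\<close> accumulates at \<open>e\<close> (lemma
  \<open>accumulates_at_homeomorphic_preimage\<close>), so some \<open>N \<subseteq> W\<close> meets that preimage in an infinite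
  set.  Then \<open>C N \<subseteq> U\<close>, and \<open>C N\<close> contains \<open>x N\<close>, which meets \<open>A\<close> in an infinite set.

  Thus left shifts carry the Pytkeev property from \<open>e\<close> to every \<open>x\<close>, while replacing the point \<open>x\<close>
  by a member of \<open>\<C>\<close> keeps the family countable.  In the converse direction, a countable Pytkeev
  network for the space serves both as the network and as the Pytkeev network at each point.
\<close>

lemma accumulates_at_homeomorphic_preimage:
  assumes f: "homeomorphic_map S T f" and x: "x \<in> topspace S"
    and acc: "accumulates_at T A (f x)"
  shows "accumulates_at S {z \<in> topspace S. f z \<in> A} x"
  unfolding accumulates_at_def
proof (intro allI impI)
  fix U assume U: "openin S U \<and> x \<in> U"
  have sub: "U \<subseteq> topspace S"
    using U openin_subset by blast
  have "openin T (f ` U)"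
    using homeomorphic_map_openness[OF f sub] U by blast
  then have "infinite (f ` U \<inter> A)"
    using acc U unfolding accumulates_at_def by blast
  moreover have "f ` U \<inter> A = f ` (U \<inter> {z \<in> topspace S. f z \<in> A})"
    using sub by blast
  ultimately show "infinite (U \<inter> {z \<in> topspace S. f z \<in> A})"
    by auto
qed

definition product_family :: "('a \<Rightarrow> 'a \<Rightarrow> 'a) \<Rightarrow> 'a set set \<Rightarrow> 'a set set \<Rightarrow> 'a set set" where
  "product_family f \<C> \<N> = (\<lambda>(C, N). (\<lambda>(x, y). f x y) ` (C \<times> N)) ` (\<C> \<times> \<N>)"

lemma countable_product_family:
  "countable \<C> \<Longrightarrow> countable \<N> \<Longrightarrow> countable (product_family f \<C> \<N>)"
  unfolding product_family_def by (intro countable_image countable_SIGMA)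

context paratopological_lop
begin

lemma neighborhoods_with_product_inside:
  assumes U: "openin T U" "x \<in> U"
  obtains V W where "openin T V" "x \<in> V" "openin T W" "e \<in> W"
    "\<And>v w. v \<in> V \<Longrightarrow> w \<in> W \<Longrightarrow> mult v w \<in> U"
proof -
  define P where "P = {p \<in> topspace (prod_topology T T). (\<lambda>(x, y). mult x y) p \<in> U}"
  have x: "x \<in> topspace T"
    using U openin_subset by blast
  have "openin (prod_topology T T) P"
    unfolding P_def by (rule openin_continuous_map_preimage[OF continuous_mult U(1)])
  moreover have "(x, e) \<in> P"
    using x U unit_closed right_unit by (auto simp: P_def)
  ultimately have "\<exists>V W. openin T V \<and> openin T W \<and> x \<in> V \<and> e \<in> W \<and> V \<times> W \<subseteq> P"
    by (simp add: openin_prod_topology_alt)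
  then obtain V W where VW: "openin T V" "x \<in> V" "openin T W" "e \<in> W" and P: "V \<times> W \<subseteq> P"
    by auto
  have "mult v w \<in> U" if "v \<in> V" "w \<in> W" for v w
    using that P unfolding P_def by auto
  with VW show thesis
    by (rule that)
qed

text \<open>
  Both conditions at \<open>x\<close> reduce to conditions at \<open>e\<close>: a set \<open>N\<close> close enough to \<open>e\<close> yields a product
  \<open>C N\<close> that stays inside \<open>U\<close> and contains the shifted set \<open>x N\<close>.  The network condition takes
  \<open>N\<close> containing \<open>e\<close>, so that \<open>x = x e\<close> lies in \<open>x N\<close>; the Pytkeev condition takes \<open>N\<close> with
  \<open>x N \<inter> A\<close> infinite.
\<close>

lemma Pytkeev_network_product_family:
  assumes net: "network T \<C>" and Pyt: "Pytkeev_network_at T \<N> e"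
  shows "Pytkeev_network T (product_family mult \<C> \<N>)"
  unfolding Pytkeev_network_def
proof
  fix x assume x: "x \<in> topspace T"
  have C_sub: "\<C> \<subseteq> Pow (topspace T)"
    and C_net: "\<And>V. openin T V \<Longrightarrow> x \<in> V \<Longrightarrow> \<exists>C\<in>\<C>. x \<in> C \<and> C \<subseteq> V"
    using net x unfolding network_def network_at_def by simp_all
  have N_sub: "\<N> \<subseteq> Pow (topspace T)"
    and N_net: "\<And>W. openin T W \<Longrightarrow> e \<in> W \<Longrightarrow> \<exists>N\<in>\<N>. e \<in> N \<and> N \<subseteq> W"
    and N_Pyt: "\<And>W B. \<lbrakk>openin T W; e \<in> W; B \<subseteq> topspace T; accumulates_at T B e\<rbrakk>
                  \<Longrightarrow> \<exists>N\<in>\<N>. N \<subseteq> W \<and> infinite (N \<inter> B)"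
    using Pyt unfolding Pytkeev_network_at_def network_at_def by simp_all
  have xe: "mult x e = x"
    using x by (rule right_unit)
  have nearby: "\<exists>W. openin T W \<and> e \<in> W \<and>
      (\<forall>N\<in>\<N>. N \<subseteq> W \<longrightarrow> (\<exists>M\<in>product_family mult \<C> \<N>. M \<subseteq> U \<and> mult x ` N \<subseteq> M))"
    if U: "openin T U" "x \<in> U" for U
  proof -
    obtain V W where VW: "openin T V" "x \<in> V" "openin T W" "e \<in> W"
      and prod: "\<And>v w. v \<in> V \<Longrightarrow> w \<in> W \<Longrightarrow> mult v w \<in> U"
      using neighborhoods_with_product_inside[OF U] by blast
    obtain C where C: "C \<in> \<C>" "x \<in> C" "C \<subseteq> V"
      using C_net VW by blast
    have "\<exists>M\<in>product_family mult \<C> \<N>. M \<subseteq> U \<and> mult x ` N \<subseteq> M"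
      if N: "N \<in> \<N>" "N \<subseteq> W" for N
    proof (intro bexI conjI)
      show "(\<lambda>(x, y). mult x y) ` (C \<times> N) \<in> product_family mult \<C> \<N>"
        using C N unfolding product_family_def by force
      show "(\<lambda>(x, y). mult x y) ` (C \<times> N) \<subseteq> U"
        using C N prod by auto
      show "mult x ` N \<subseteq> (\<lambda>(x, y). mult x y) ` (C \<times> N)"
        using C by force
    qed
    then show ?thesis
      using VW by blast
  qed
  have "product_family mult \<C> \<N> \<subseteq> Pow (topspace T)"
    using C_sub N_sub mult_closed unfolding product_family_def by fastforce
  moreover have "\<exists>M\<in>product_family mult \<C> \<N>. x \<in> M \<and> M \<subseteq> U"
    if U: "openin T U" "x \<in> U" for U
  proof -
    obtain W where W: "openin T W" "e \<in> W"
      and M: "\<forall>N\<in>\<N>. N \<subseteq> W \<longrightarrow>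
                (\<exists>M\<in>product_family mult \<C> \<N>. M \<subseteq> U \<and> mult x ` N \<subseteq> M)"
      using nearby[OF U] by (elim exE conjE)
    obtain N where N: "N \<in> \<N>" "e \<in> N" "N \<subseteq> W"
      using N_net W by blast
    have "x \<in> mult x ` N"
      using N(2) xe by force
    then show ?thesis
      using M[rule_format, OF N(1,3)] by blast
  qed
  moreover have "\<exists>M\<in>product_family mult \<C> \<N>. M \<subseteq> U \<and> infinite (M \<inter> A)"
    if U: "openin T U" "x \<in> U" and A: "accumulates_at T A x" for U A
  proof -
    obtain W where W: "openin T W" "e \<in> W"
      and M: "\<forall>N\<in>\<N>. N \<subseteq> W \<longrightarrow>
                (\<exists>M\<in>product_family mult \<C> \<N>. M \<subseteq> U \<and> mult x ` N \<subseteq> M)"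
      using nearby[OF U] by (elim exE conjE)
    define B where "B = {z \<in> topspace T. mult x z \<in> A}"
    have B_sub: "B \<subseteq> topspace T"
      unfolding B_def by blast
    have "accumulates_at T B e"
      unfolding B_def
      using accumulates_at_homeomorphic_preimage[OF homeomorphic_left_shift[OF x] unit_closed] A xe
      by simp
    then obtain N where N: "N \<in> \<N>" "N \<subseteq> W" and inf: "infinite (N \<inter> B)"
      using N_Pyt[OF W B_sub] by blast
    have "inj_on (mult x) (N \<inter> B)"
      using bij_left_shift[OF x] unfolding B_def bij_betw_def
      by (auto intro: inj_on_subset)
    then have inf': "infinite (mult x ` (N \<inter> B))"
      using inf finite_imageD by blast
    have image_sub: "mult x ` (N \<inter> B) \<subseteq> mult x ` N \<inter> A"
      unfolding B_def by blast
    obtain M' where M': "M' \<in> product_family mult \<C> \<N>" "M' \<subseteq> U" "mult x ` N \<subseteq> M'"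
      using M[rule_format, OF N] by blast
    have "mult x ` (N \<inter> B) \<subseteq> M' \<inter> A"
      using image_sub M'(3) by blast
    then have "infinite (M' \<inter> A)"
      using inf' infinite_super by blast
    then show ?thesis
      using M' by blast
  qed
  ultimately show "Pytkeev_network_at T (product_family mult \<C> \<N>) x"
    unfolding Pytkeev_network_at_def network_at_def by simp
qed

end

theorem theorem4p6:
  fixes T :: "'a topology" and mult :: "'a \<Rightarrow> 'a \<Rightarrow> 'a" and e :: 'a
  assumes "paratopological_lop T mult e"
  shows "P0_space T \<longleftrightarrow> cosmic_space T \<and> strong_Pytkeev_property T"
proof
  assume "P0_space T"
  then show "cosmic_space T \<and> strong_Pytkeev_property T"
    unfolding P0_space_def cosmic_space_def strong_Pytkeev_property_def
      Pytkeev_network_def network_def by (metis Pytkeev_network_at_def)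
next
  interpret paratopological_lop T mult e by (fact assms)
  assume *: "cosmic_space T \<and> strong_Pytkeev_property T"
  then obtain \<C> where T3: "T3_space T" and C: "countable \<C>" "network T \<C>"
    unfolding cosmic_space_def by blast
  obtain \<N> where N: "countable \<N>" "Pytkeev_network_at T \<N> e"
    using * unit_closed unfolding strong_Pytkeev_property_def by blast
  show "P0_space T"
    unfolding P0_space_def
    using T3 countable_product_family[OF C(1) N(1)] Pytkeev_network_product_family[OF C(2) N(2)]
    by blast
qed

end
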